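(* Suppose that $(k_1+k_2)\mid k_1^2$ and put $\theta^*=\dfrac{k_1^2}{k_1+k_2}=\dfrac{k_1^2}{v}$. Then every $\mathrm{ECD}(\theta^* )$ in $\mathcal D(v,r;k_1,k_2)$ is Schur-optimal: if $d^*\in\mathcal D(v,r;k_1,k_2)$ is an $\mathrm{ECD}(\theta^* )$, then $\sum_{i=1}^{v-1}f(z_{d^*i})\le\sum_{i=1}^{v-1}f(z_{di})$ for every $d\in\mathcal D(v,r;k_1,k_2)$ and every convex $f:(0,\infty)\to\mathbb R$.
   Context: Let $k_1\ge k_2\ge 2$ be integers, $v=k_1+k_2$, and $2\le r\le v-1$. A resolvable design $d$ consists of $r$ replicates, each replicate being a partition of a fixed set of $v$ treatments into two blocks, one of size $k_1$ and one of size $k_2$ (if $k_1=k_2$, one block of each replicate is designated as "the block of size $k_1$"). Let $N_d$ be the $v\times 2r$ zero-one treatment/block incidence matrix, $D_s=\mathrm{Diag}(k_1,k_2,k_1,k_2,\dots,k_1,k_2)$ the diagonal matrix of block sizes, and $C_d=rI-N_dD_s^{-1}N_d'$ the information matrix. The design is connected if $C_d$ has rank $v-1$; only connected designs are considered, and $\mathcal D(v,r;k_1,k_2)$ denotes the class of all of them. The nonzero eigenvalues of $C_d$ are $z_{d1}\le z_{d2}\le\dots\le z_{d,v-1}$. For $h\ne h'$, $\phi_{dhh'}$ is the number of treatments common to the blocks of size $k_1$ in replicates $h$ and $h'$. A design $d$ is an equal concurrence design $\mathrm{ECD}(\theta)$ if $\phi_{dhh'}=\theta$ for all $h\neq h'$.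 *)

theory Defs
  imports
    "HOL-Analysis.Convex"
    "HOL-Computational_Algebra.Polynomial"
    "Jordan_Normal_Form.Char_Poly"
    "Jordan_Normal_Form.DL_Rank"
    "Jordan_Normal_Form.Gauss_Jordan_Elimination"
begin

(* Treatments are 0, ..., v - 1 and replicates are 0, ..., r - 1; the value of a design at h \<ge> r
   is irrelevant.  A replicate is the pair (block of size k1, block of size k2), so that the order
   of the pair is the required designation when k1 = k2. *)
type_synonym design = "nat \<Rightarrow> nat set \<times> nat set"

definition is_replicate :: "nat \<Rightarrow> nat \<Rightarrow> nat \<Rightarrow> nat set \<times> nat set \<Rightarrow> bool" where
  "is_replicate v k1 k2 p \<longleftrightarrow>
     fst p \<union> snd p = {..<v} \<and> fst p \<inter> snd p = {} \<and> card (fst p) = k1 \<and> card (snd p) = k2"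

definition is_design :: "nat \<Rightarrow> nat \<Rightarrow> nat \<Rightarrow> nat \<Rightarrow> design \<Rightarrow> bool" where
  "is_design v r k1 k2 d \<longleftrightarrow> (\<forall>h<r. is_replicate v k1 k2 (d h))"

(* The 2r blocks in the order of the columns of the incidence matrix: block 2h is the block of
   size k1 and block 2h + 1 the block of size k2 of replicate h. *)
definition block :: "design \<Rightarrow> nat \<Rightarrow> nat set" where
  "block d j = (if even j then fst (d (j div 2)) else snd (d (j div 2)))"

definition incidence_mat :: "nat \<Rightarrow> nat \<Rightarrow> design \<Rightarrow> real mat" where
  "incidence_mat v r d = mat v (2 * r) (\<lambda>(i, j). of_bool (i \<in> block d j))"

definition block_size_mat :: "nat \<Rightarrow> nat \<Rightarrow> nat \<Rightarrow> real mat" where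
  "block_size_mat r k1 k2 = mat_diag (2 * r) (\<lambda>j. if even j then real k1 else real k2)"

definition information_mat :: "nat \<Rightarrow> nat \<Rightarrow> nat \<Rightarrow> nat \<Rightarrow> design \<Rightarrow> real mat" where
  "information_mat v r k1 k2 d =
     real r \<cdot>\<^sub>m 1\<^sub>m v -
     incidence_mat v r d * the (mat_inverse (block_size_mat r k1 k2)) * transpose_mat (incidence_mat v r d)"

(* For positive block sizes the inverse above exists, so the option value is not None. *)
lemma mat_inverse_block_size_mat:
  assumes "k1 > 0" "k2 > 0"
  shows "mat_inverse (block_size_mat r k1 k2) =
    Some (mat_diag (2 * r) (\<lambda>j. if even j then 1 / real k1 else 1 / real k2))"
proof -
  define A where "A = block_size_mat r k1 k2"
  define B :: "real mat" where "B = mat_diag (2 * r) (\<lambda>j. if even j then 1 / real k1 else 1 / real k2)"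
  have A: "A \<in> carrier_mat (2 * r) (2 * r)" and B: "B \<in> carrier_mat (2 * r) (2 * r)"
    unfolding A_def B_def block_size_mat_def by auto
  have AB: "A * B = 1\<^sub>m (2 * r)" and BA: "B * A = 1\<^sub>m (2 * r)"
    unfolding A_def B_def block_size_mat_def mat_diag_diag using assms
    by (auto simp: mat_diag_def intro!: eq_matI)
  have "mat_inverse A \<noteq> None"
  proof
    assume "mat_inverse A = None"
    from mat_inverse(1)[OF A this, of "()"] have "A \<notin> Units (ring_mat TYPE(real) (2 * r) ())" .
    moreover have "A \<in> Units (ring_mat TYPE(real) (2 * r) ())"
      using A B AB BA by (auto simp: Units_def ring_mat_simps)
    ultimately show False by blast
  qed
  then obtain C where C: "mat_inverse A = Some C" by blast
  from mat_inverse(2)[OF A C] have "C * A = 1\<^sub>m (2 * r)" "C \<in> carrier_mat (2 * r) (2 * r)" by auto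
  then have "C = B"
    using A B AB by (metis assoc_mult_mat left_mult_one_mat right_mult_one_mat)
  with C show ?thesis by (simp add: A_def B_def)
qed

definition connected_design :: "nat \<Rightarrow> nat \<Rightarrow> nat \<Rightarrow> nat \<Rightarrow> design \<Rightarrow> bool" where
  "connected_design v r k1 k2 d \<longleftrightarrow> vec_space.rank v (information_mat v r k1 k2 d) = v - 1"

definition design_class :: "nat \<Rightarrow> nat \<Rightarrow> nat \<Rightarrow> nat \<Rightarrow> design set" where
  "design_class v r k1 k2 = {d. is_design v r k1 k2 d \<and> connected_design v r k1 k2 d}"

(* The nonzero eigenvalues in increasing order, repeated according to multiplicity.  The
   information matrix is real symmetric, so no eigenvalue is lost by taking real roots only; for a
   connected design the list has length v - 1. *)
definition nonzero_eigenvalues :: "nat \<Rightarrow> nat \<Rightarrow> nat \<Rightarrow> nat \<Rightarrow> design \<Rightarrow> real list" where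
  "nonzero_eigenvalues v r k1 k2 d =
     sorted_list_of_multiset (filter_mset (\<lambda>x. x \<noteq> 0) (proots (char_poly (information_mat v r k1 k2 d))))"

definition eigenval :: "nat \<Rightarrow> nat \<Rightarrow> nat \<Rightarrow> nat \<Rightarrow> design \<Rightarrow> nat \<Rightarrow> real" where
  "eigenval v r k1 k2 d i = nonzero_eigenvalues v r k1 k2 d ! (i - 1)"

definition concurrence :: "design \<Rightarrow> nat \<Rightarrow> nat \<Rightarrow> nat" where
  "concurrence d h h' = card (fst (d h) \<inter> fst (d h'))"

definition is_ECD :: "nat \<Rightarrow> nat \<Rightarrow> design \<Rightarrow> bool" where
  "is_ECD r \<theta> d \<longleftrightarrow> (\<forall>h<r. \<forall>h'<r. h \<noteq> h' \<longrightarrow> concurrence d h h' = \<theta>)"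

definition Schur_optimal :: "nat \<Rightarrow> nat \<Rightarrow> nat \<Rightarrow> nat \<Rightarrow> design \<Rightarrow> bool" where
  "Schur_optimal v r k1 k2 d' \<longleftrightarrow>
     d' \<in> design_class v r k1 k2 \<and>
     (\<forall>d \<in> design_class v r k1 k2. \<forall>f :: real \<Rightarrow> real. convex_on {0<..} f \<longrightarrow>
        (\<Sum>i = 1..v - 1. f (eigenval v r k1 k2 d' i)) \<le> (\<Sum>i = 1..v - 1. f (eigenval v r k1 k2 d i)))"

end

theory Submission
  imports Defs "Jordan_Normal_Form.Schur_Decomposition"
begin

text \<open>
  Let \<open>x\<^sub>h\<close> and \<open>y\<^sub>h\<close> be the indicator vectors of the two blocks of replicate \<open>h\<close>. Their span
  contains the all-ones vector \<open>1\<close>, so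
  \<open>x\<^sub>h x\<^sub>h' / k1 + y\<^sub>h y\<^sub>h' / k2\<close>, the orthogonal projection onto that span, equals
  \<open>J / v + w\<^sub>h w\<^sub>h'\<close>, where \<open>J\<close> is the all-ones matrix and \<open>w\<^sub>h\<close> is a unit vector orthogonal to \<open>1\<close>
  (lemma \<open>information_mat_index\<close>). With \<open>W\<close> the \<open>v\<close> by \<open>r\<close> matrix of columns \<open>w\<^sub>h\<close>, the information
  matrix is therefore \<open>C = r I - (r / v) J - W W'\<close>.

  Since \<open>W W'\<close> and the \<open>r\<close> by \<open>r\<close> Gram matrix \<open>W' W\<close> have the same nonzero eigenvalues, the spectrum
  of \<open>C\<close> consists of \<open>0\<close>, of \<open>v - 1 - r\<close> copies of \<open>r\<close> that do not depend on the design, and of the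
  eigenvalues of \<open>H = r I - W' W\<close> (lemma \<open>char_poly_information_mat\<close>). The diagonal of \<open>H\<close> is constantly
  \<open>r - 1\<close>, so its \<open>r\<close> eigenvalues have the fixed mean \<open>r - 1\<close>; and for a connected design they are
  positive (lemma \<open>reduced_mat_spectrum\<close>). By Jensen's inequality
  \<open>r f(r - 1)\<close> is a lower bound for the sum of \<open>f\<close> over them. The bound is attained when \<open>H = (r - 1) I\<close>,
  that is, when the \<open>w\<^sub>h\<close> are orthonormal. Now \<open>w\<^sub>h\<close> and \<open>w\<^sub>g\<close> are orthogonal exactly when the two blocks
  of size \<open>k1\<close> share \<open>k1\<^sup>2 / v\<close> treatments (lemma \<open>contrast_inner_product\<close>), which is the definition of
  the equal concurrence designs in question.
\<close>

section \<open>Exchanging the factors of a product in a characteristic polynomial\<close>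

text \<open>
  Both sides are the determinant of a product of the block matrices \<open>X = [t I, -A; B, I]\<close> and
  \<open>Y = [I, 0; -B, t I]\<close>: each of \<open>X Y\<close> and \<open>Y X\<close> is block triangular, and the two have equal determinants.
\<close>
lemma det_scalar_plus_mult_swap:
  fixes A B :: "'a :: idom mat"
  assumes A: "A \<in> carrier_mat n m" and B: "B \<in> carrier_mat m n"
  shows "det (t \<cdot>\<^sub>m 1\<^sub>m n + A * B) * t ^ m = t ^ n * det (t \<cdot>\<^sub>m 1\<^sub>m m + B * A)"
proof -
  let ?X = "four_block_mat (t \<cdot>\<^sub>m 1\<^sub>m n) (- A) B (1\<^sub>m m)"
  let ?Y = "four_block_mat (1\<^sub>m n) (0\<^sub>m n m) (- B) (t \<cdot>\<^sub>m 1\<^sub>m m)"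
  have "?X * ?Y = four_block_mat (t \<cdot>\<^sub>m 1\<^sub>m n + A * B) (- (t \<cdot>\<^sub>m A)) (0\<^sub>m m n) (t \<cdot>\<^sub>m 1\<^sub>m m)"
    using A B by (subst mult_four_block_mat[of _ n n _ m _ m _ _ n _ m])
      (auto intro!: cong_four_block_mat eq_matI simp: mult_smult_distrib[of _ _ m])
  then have "det ?X * det ?Y = det (t \<cdot>\<^sub>m 1\<^sub>m n + A * B) * t ^ m"
    using A B by (subst det_mult[symmetric, of _ "n + m"])
      (auto simp: det_four_block_mat_lower_left_zero[of _ n _ m])
  moreover have "?Y * ?X = four_block_mat (t \<cdot>\<^sub>m 1\<^sub>m n) (- A) (0\<^sub>m m n) (t \<cdot>\<^sub>m 1\<^sub>m m + B * A)"
    using A B by (subst mult_four_block_mat[of _ n n _ m _ m _ _ n _ m])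
      (auto intro!: cong_four_block_mat eq_matI simp: mult_smult_distrib[of _ _ m])
  then have "det ?Y * det ?X = t ^ n * det (t \<cdot>\<^sub>m 1\<^sub>m m + B * A)"
    using A B by (subst det_mult[symmetric, of _ "n + m"])
      (auto simp: det_four_block_mat_lower_left_zero[of _ n _ m])
  ultimately show ?thesis by (simp add: mult.commute)
qed

text \<open>
  The linear factor \<open>[:- c, 1:]\<close> is \<open>x - c\<close>, so this is the preceding identity over the polynomial ring
  with \<open>t = x - c\<close>.
\<close>
lemma char_poly_scalar_minus_mult_swap:
  fixes A B :: "'a :: idom mat"
  assumes A: "A \<in> carrier_mat n m" and B: "B \<in> carrier_mat m n"
  shows "char_poly (c \<cdot>\<^sub>m 1\<^sub>m n - A * B) * [:- c, 1:] ^ m =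
    [:- c, 1:] ^ n * char_poly (c \<cdot>\<^sub>m 1\<^sub>m m - B * A)"
proof -
  have const_sum: "(\<Sum>i\<in>S. [:g i:]) = [:\<Sum>i\<in>S. g i:]" for S :: "nat set" and g :: "nat \<Rightarrow> 'a"
    by (induction S rule: infinite_finite_induct) auto
  have hom: "char_poly (c \<cdot>\<^sub>m 1\<^sub>m k - X * Y) =
      det ([:- c, 1:] \<cdot>\<^sub>m 1\<^sub>m k + map_mat (\<lambda>a. [:a:]) X * map_mat (\<lambda>a. [:a:]) Y)"
    if X: "X \<in> carrier_mat k l" and Y: "Y \<in> carrier_mat l k" for X Y :: "'a mat" and k l
  proof -
    have "map_mat (\<lambda>a. [:a:]) X * map_mat (\<lambda>a. [:a:]) Y = map_mat (\<lambda>a. [:a:]) (X * Y)"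
      using X Y by (intro eq_matI) (auto simp: scalar_prod_def const_sum mult.commute)
    moreover have "char_poly_matrix (c \<cdot>\<^sub>m 1\<^sub>m k - X * Y) =
        [:- c, 1:] \<cdot>\<^sub>m 1\<^sub>m k + map_mat (\<lambda>a. [:a:]) (X * Y)"
      using X Y unfolding char_poly_matrix_def by (intro eq_matI) auto
    ultimately show ?thesis by (simp add: char_poly_def)
  qed
  show ?thesis
    unfolding hom[OF A B] hom[OF B A] using A B
    by (intro det_scalar_plus_mult_swap) auto
qed

section \<open>Rank and kernel vectors\<close>

lemma (in vec_space) rank_sum_outer_products:
  assumes "finite S"
  shows "rank (mat n nc (\<lambda>(i, j). \<Sum>k\<in>S. f k i * g k j)) \<le> card S"
  using assms
proof induction
  case empty
  have "mat n nc (\<lambda>_. 0) = (0\<^sub>m n nc :: 'a mat)" by (intro eq_matI) auto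
  then show ?case by (simp add: rank_0I)
next
  case (insert a S)
  let ?M = "mat n nc (\<lambda>(i, j). \<Sum>k\<in>S. f k i * g k j)"
  let ?N = "mat n nc (\<lambda>(i, j). f a i * g a j)"
  have "mat n nc (\<lambda>(i, j). \<Sum>k\<in>insert a S. f k i * g k j) = ?N + ?M"
    using insert by (intro eq_matI) auto
  moreover have "rank (?N + ?M) \<le> rank ?N + rank ?M" by (intro rank_subadditive) auto
  moreover have "rank ?N \<le> 1" by (rule rank_le_1_product_entries[of _ nc "f a" "g a"]) auto
  ultimately show ?case using insert by simp
qed

text \<open>
  A nonzero minor of the two kernel vectors lets them be normalised to unit vectors in the positions
  \<open>a\<close> and \<open>b\<close>. These express the columns \<open>a\<close> and \<open>b\<close> through the other \<open>nc - 2\<close> columns, and so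
  write the matrix as a sum of \<open>nc - 2\<close> outer products.
\<close>
lemma (in vec_space) rank_le_if_two_kernel_vectors:
  assumes A: "A \<in> carrier_mat n nc"
    and x: "\<And>i. i < n \<Longrightarrow> (\<Sum>k<nc. A $$ (i, k) * x k) = 0"
    and y: "\<And>i. i < n \<Longrightarrow> (\<Sum>k<nc. A $$ (i, k) * y k) = 0"
    and ab: "a < nc" "b < nc" and indep: "x a * y b - x b * y a \<noteq> 0"
  shows "rank A \<le> nc - 2"
proof -
  define \<Delta> where "\<Delta> = x a * y b - x b * y a"
  define p where "p k = (y b * x k - x b * y k) / \<Delta>" for k
  define q where "q k = (x a * y k - y a * x k) / \<Delta>" for k
  have pq: "p a = 1" "p b = 0" "q a = 0" "q b = 1"
    using indep by (auto simp: p_def q_def \<Delta>_def field_simps)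
  have p0: "(\<Sum>k<nc. A $$ (i, k) * p k) = 0" if "i < n" for i
  proof -
    have "(\<Sum>k<nc. A $$ (i, k) * p k) =
        (y b * (\<Sum>k<nc. A $$ (i, k) * x k) - x b * (\<Sum>k<nc. A $$ (i, k) * y k)) / \<Delta>"
      unfolding sum_distrib_left sum_subtractf[symmetric] sum_divide_distrib p_def
      by (intro sum.cong) (auto simp: field_simps)
    then show ?thesis using x y that by simp
  qed
  have q0: "(\<Sum>k<nc. A $$ (i, k) * q k) = 0" if "i < n" for i
  proof -
    have "(\<Sum>k<nc. A $$ (i, k) * q k) =
        (x a * (\<Sum>k<nc. A $$ (i, k) * y k) - y a * (\<Sum>k<nc. A $$ (i, k) * x k)) / \<Delta>"
      unfolding sum_distrib_left sum_subtractf[symmetric] sum_divide_distrib q_def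
      by (intro sum.cong) (auto simp: field_simps)
    then show ?thesis using x y that by simp
  qed
  have neq: "a \<noteq> b" using indep by auto
  define S where "S = {..<nc} - {a, b}"
  \<comment> \<open>Row \<open>k\<close> of \<open>I - p e\<^sub>a' - q e\<^sub>b'\<close>. Multiplying by this matrix on the right does not change \<open>A\<close>,
      because \<open>A p = A q = 0\<close>, while its rows \<open>a\<close> and \<open>b\<close> vanish.\<close>
  define g where "g k j = of_bool (k = j) - p k * of_bool (j = a) - q k * of_bool (j = b)" for k j
  have "A = mat n nc (\<lambda>(i, j). \<Sum>k\<in>S. A $$ (i, k) * g k j)"
  proof (rule eq_matI)
    fix i j
    assume "i < dim_row (mat n nc (\<lambda>(i, j). \<Sum>k\<in>S. A $$ (i, k) * g k j))"
      and "j < dim_col (mat n nc (\<lambda>(i, j). \<Sum>k\<in>S. A $$ (i, k) * g k j))"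
    then have ij: "i < n" "j < nc" by auto
    have "(\<Sum>k\<in>S. A $$ (i, k) * g k j) = (\<Sum>k<nc. A $$ (i, k) * g k j)"
      unfolding S_def using neq pq ab by (intro sum.mono_neutral_left) (auto simp: g_def)
    also have "\<dots> = (\<Sum>k<nc. if k = j then A $$ (i, k) else 0)
        - of_bool (j = a) * (\<Sum>k<nc. A $$ (i, k) * p k)
        - of_bool (j = b) * (\<Sum>k<nc. A $$ (i, k) * q k)"
      unfolding sum_distrib_left sum_subtractf[symmetric] g_def
      by (intro sum.cong) (auto simp: algebra_simps)
    also have "\<dots> = A $$ (i, j)" using ij p0 q0 by simp
    finally show "A $$ (i, j) = mat n nc (\<lambda>(i, j). \<Sum>k\<in>S. A $$ (i, k) * g k j) $$ (i, j)"
      using ij by simp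
  qed (use A in auto)
  moreover have "card S = nc - 2" using ab neq by (simp add: S_def card_Diff_subset)
  ultimately show ?thesis
    using rank_sum_outer_products[of S nc "\<lambda>k i. A $$ (i, k)" g] by (simp add: S_def)
qed

section \<open>Eigenvalues of real symmetric matrices\<close>

text \<open>
  The complex characteristic polynomial splits. Each of its roots \<open>c\<close> is real, because for an
  eigenvector \<open>z\<close> the number \<open>T = z\<^sup>* A z = c |z|\<^sup>2\<close> is its own conjugate by symmetry of \<open>A\<close>.
\<close>
lemma real_symmetric_char_poly_splits:
  fixes A :: "real mat"
  assumes A: "A \<in> carrier_mat n n" and sym: "\<And>i j. i < n \<Longrightarrow> j < n \<Longrightarrow> A $$ (i, j) = A $$ (j, i)"
  obtains es where "char_poly A = (\<Prod>e\<leftarrow>es. [:- e, 1:])" "length es = n"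
proof -
  let ?A = "map_mat complex_of_real A"
  have cA: "?A \<in> carrier_mat n n" using A by auto
  obtain cs where cs: "char_poly ?A = (\<Prod>c\<leftarrow>cs. [:- c, 1:])" "length cs = n"
    using char_poly_factorized[OF cA] by blast
  have real: "complex_of_real (Re c) = c" if "c \<in> set cs" for c
  proof -
    have "poly (char_poly ?A) c = 0"
      unfolding cs using that by (simp add: poly_prod_list prod_list_zero_iff)
    then obtain z where z: "z \<in> carrier_vec n" "z \<noteq> 0\<^sub>v n" "?A *\<^sub>v z = c \<cdot>\<^sub>v z"
      unfolding eigenvalue_root_char_poly[OF cA, symmetric] eigenvalue_def eigenvector_def
      using A by auto
    have row: "(\<Sum>j<n. A $$ (i, j) * z $ j) = c * z $ i" if "i < n" for i
    proof -
      have "(?A *\<^sub>v z) $ i = (c \<cdot>\<^sub>v z) $ i" using z by simp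
      then show ?thesis using that A z(1) by (auto simp: scalar_prod_def lessThan_atLeast0)
    qed
    define T where "T = (\<Sum>i<n. \<Sum>j<n. cnj (z $ i) * A $$ (i, j) * z $ j)"
    define N where "N = (\<Sum>i<n. (cmod (z $ i))\<^sup>2)"
    have "T = (\<Sum>i<n. cnj (z $ i) * (c * z $ i))"
      unfolding T_def by (intro sum.cong refl) (simp add: row[symmetric] sum_distrib_left mult.assoc)
    also have "\<dots> = c * of_real N"
      unfolding N_def of_real_sum sum_distrib_left
      by (intro sum.cong refl) (simp add: complex_norm_square[symmetric] algebra_simps complex_norm_square)
    finally have T: "T = c * of_real N" .
    have "cnj T = (\<Sum>i<n. \<Sum>j<n. z $ i * A $$ (i, j) * cnj (z $ j))"
      unfolding T_def by simp
    also have "\<dots> = (\<Sum>j<n. \<Sum>i<n. z $ i * A $$ (i, j) * cnj (z $ j))" by (rule sum.swap)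
    also have "\<dots> = T"
      unfolding T_def by (intro sum.cong refl) (auto simp: sym algebra_simps)
    finally have "cnj T = T" .
    then have "cnj c * of_real N = c * of_real N" unfolding T by simp
    moreover have "N > 0"
    proof -
      obtain i where "i < n" "z $ i \<noteq> 0" using z by (metis eq_vecI carrier_vecD index_zero_vec)
      then show ?thesis unfolding N_def by (intro sum_pos2[of _ i]) auto
    qed
    ultimately have "cnj c = c" by simp
    then show ?thesis by (metis Reals_cnj_iff of_real_Re)
  qed
  let ?es = "map Re cs"
  interpret hp: map_poly_inj_idom_hom complex_of_real ..
  have "map_poly complex_of_real (char_poly A) = char_poly ?A"
    using A by (simp add: of_real_hom.char_poly_hom)
  also have "\<dots> = (\<Prod>c\<leftarrow>cs. map_poly complex_of_real [:- Re c, 1:])"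
    unfolding cs by (intro arg_cong[where f = prod_list] map_cong refl) (auto simp: real)
  also have "\<dots> = map_poly complex_of_real (\<Prod>e\<leftarrow>?es. [:- e, 1:])"
    by (simp add: hp.hom_prod_list o_def)
  finally have "char_poly A = (\<Prod>e\<leftarrow>?es. [:- e, 1:])" by simp
  then show ?thesis using cs by (intro that[of ?es]) auto
qed

text \<open>
  The Schur decomposition makes \<open>A\<close> similar to a triangular matrix with the roots on its diagonal, and
  the trace is invariant under similarity.
\<close>
lemma sum_roots_char_poly:
  fixes A :: "real mat"
  assumes A: "A \<in> carrier_mat n n" and es: "char_poly A = (\<Prod>e\<leftarrow>es. [:- e, 1:])"
  shows "sum_list es = (\<Sum>i<n. A $$ (i, i))"
proof -
  obtain B P Q where dec: "schur_decomposition A es = (B, P, Q)" by (metis prod_cases3)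
  from schur_decomposition[OF A es dec] have wit: "similar_mat_wit A B P Q" and diag: "diag_mat B = es"
    by auto
  from similar_mat_witD2[OF A wit] have c: "B \<in> carrier_mat n n" "P \<in> carrier_mat n n" "Q \<in> carrier_mat n n"
    and QP: "Q * P = 1\<^sub>m n" and A_eq: "A = P * B * Q" by auto
  have comm: "(\<Sum>i<n. (X * Y) $$ (i, i)) = (\<Sum>i<n. (Y * X) $$ (i, i))"
    if "X \<in> carrier_mat n n" "Y \<in> carrier_mat n n" for X Y :: "real mat"
  proof -
    have "(\<Sum>i<n. (X * Y) $$ (i, i)) = (\<Sum>i<n. \<Sum>j<n. X $$ (i, j) * Y $$ (j, i))"
      using that by (auto simp: scalar_prod_def lessThan_atLeast0)
    also have "\<dots> = (\<Sum>j<n. \<Sum>i<n. X $$ (i, j) * Y $$ (j, i))" by (rule sum.swap)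
    also have "\<dots> = (\<Sum>i<n. (Y * X) $$ (i, i))"
      using that by (auto simp: scalar_prod_def lessThan_atLeast0 mult.commute)
    finally show ?thesis .
  qed
  have "(\<Sum>i<n. A $$ (i, i)) = (\<Sum>i<n. (Q * (P * B)) $$ (i, i))"
    unfolding A_eq using c by (intro comm) auto
  also have "Q * (P * B) = B" using c QP by (simp flip: assoc_mult_mat[of _ n n _ n _ n])
  also have "(\<Sum>i<n. B $$ (i, i)) = sum_list es"
    unfolding diag[symmetric] diag_mat_def using c
    by (simp add: interv_sum_list_conv_sum_set_nat lessThan_atLeast0)
  finally show ?thesis by simp
qed

section \<open>The contrasts of a design\<close>

text \<open>
  The unit vector \<open>w\<^sub>h\<close>: up to sign the only one that is constant on each block of replicate \<open>h\<close>
  and orthogonal to the all-ones vector.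
\<close>
definition contrast :: "nat \<Rightarrow> nat \<Rightarrow> design \<Rightarrow> nat \<Rightarrow> nat \<Rightarrow> real" where
  "contrast k1 k2 d h i = sqrt (real k1 * real k2 / real (k1 + k2)) *
     (if i \<in> fst (d h) then 1 / real k1 else - (1 / real k2))"

text \<open>The matrix \<open>H = r I - W' W\<close>, where \<open>W\<close> has the contrasts as columns.\<close>
definition reduced_mat :: "nat \<Rightarrow> nat \<Rightarrow> nat \<Rightarrow> nat \<Rightarrow> design \<Rightarrow> real mat" where
  "reduced_mat v r k1 k2 d = mat r r (\<lambda>(a, b).
     (if a = b then real r else 0) - (\<Sum>i<v. contrast k1 k2 d a i * contrast k1 k2 d b i))"

lemma reduced_mat_carrier [simp]: "reduced_mat v r k1 k2 d \<in> carrier_mat r r"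
  by (simp add: reduced_mat_def)

context
  fixes v r k1 k2 :: nat and d :: design
  assumes pos: "k1 > 0" "k2 > 0" and v: "v = k1 + k2" and design: "is_design v r k1 k2 d"
begin

lemma replicate_blocks:
  assumes "h < r"
  shows "fst (d h) \<subseteq> {..<v}" "card (fst (d h)) = k1" "snd (d h) = {..<v} - fst (d h)"
  using design assms unfolding is_design_def is_replicate_def by auto

lemma sum_contrast_times:
  assumes "h < r"
  shows "(\<Sum>i<v. contrast k1 k2 d h i * g i) = sqrt (real k1 * real k2 / real v) *
    ((\<Sum>i\<in>fst (d h). g i) / real k1 - (\<Sum>i\<in>{..<v} - fst (d h). g i) / real k2)"
proof -
  let ?X = "fst (d h)" and ?c = "sqrt (real k1 * real k2 / real v)"
  have "(\<Sum>i<v. contrast k1 k2 d h i * g i) =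
      (\<Sum>i\<in>?X. contrast k1 k2 d h i * g i) + (\<Sum>i\<in>{..<v} - ?X. contrast k1 k2 d h i * g i)"
    using replicate_blocks(1)[OF assms] by (simp add: sum.subset_diff[of ?X] add.commute)
  also have "(\<Sum>i\<in>?X. contrast k1 k2 d h i * g i) = (?c / real k1) * (\<Sum>i\<in>?X. g i)"
    unfolding sum_distrib_left by (intro sum.cong) (auto simp: contrast_def v)
  also have "(\<Sum>i\<in>{..<v} - ?X. contrast k1 k2 d h i * g i) = (- ?c / real k2) * (\<Sum>i\<in>{..<v} - ?X. g i)"
    unfolding sum_distrib_left by (intro sum.cong) (auto simp: contrast_def v)
  finally show ?thesis by (simp add: algebra_simps)
qed

lemma sum_contrast:
  assumes "h < r"
  shows "(\<Sum>i<v. contrast k1 k2 d h i) = 0"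
  using sum_contrast_times[OF assms, of "\<lambda>_. 1"] replicate_blocks[OF assms] pos v
  by (simp add: card_Diff_subset finite_subset[of _ "{..<v}"])

text \<open>
  The vector \<open>w\<^sub>h\<close> is constant on each block of \<open>h\<close>. As \<open>w\<^bsub>h'\<^esub>\<close> sums to zero, its sums over these two
  blocks are opposite, so the inner product is a multiple of the sum of \<open>w\<^bsub>h'\<^esub>\<close> over the block of size
  \<open>k1\<close> of \<open>h\<close>, which the concurrence determines.
\<close>
lemma contrast_inner_product:
  assumes h: "h < r" and h': "h' < r"
  shows "(\<Sum>i<v. contrast k1 k2 d h i * contrast k1 k2 d h' i) =
    (real (concurrence d h h') * real v - (real k1)\<^sup>2) / (real k1 * real k2)"
proof -
  let ?X = "fst (d h)" and ?Y = "fst (d h')" and ?c = "sqrt (real k1 * real k2 / real v)"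
  let ?w = "contrast k1 k2 d h'"
  let ?\<phi> = "concurrence d h h'"
  have fin: "finite ?X" using replicate_blocks[OF h] finite_subset by blast
  have le: "?\<phi> \<le> k1"
    unfolding concurrence_def using card_mono[OF fin, of "?X \<inter> ?Y"] replicate_blocks[OF h] by auto
  have "(\<Sum>i\<in>?X. ?w i) = (\<Sum>i\<in>?X \<inter> ?Y. ?w i) + (\<Sum>i\<in>?X - ?Y. ?w i)"
    using fin by (metis sum.Int_Diff)
  also have "\<dots> = ?c * (real ?\<phi> / real k1 - (real k1 - real ?\<phi>) / real k2)"
    using fin le replicate_blocks[OF h]
    by (simp add: contrast_def v concurrence_def card_Diff_subset_Int of_nat_diff algebra_simps)
  finally have X: "(\<Sum>i\<in>?X. ?w i) = ?c * (real ?\<phi> / real k1 - (real k1 - real ?\<phi>) / real k2)" .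
  have "(\<Sum>i\<in>{..<v} - ?X. ?w i) = - (\<Sum>i\<in>?X. ?w i)"
    using sum_contrast[OF h'] replicate_blocks(1)[OF h] by (simp add: sum.subset_diff[of ?X "{..<v}"])
  moreover have factor: "c * (c * E / p - - (c * E) / q) = c * c * E * (1 / p + 1 / q)" for c E p q :: real
    by (simp add: divide_inverse algebra_simps)
  ultimately have "(\<Sum>i<v. contrast k1 k2 d h i * ?w i) = ?c * ?c *
      (real ?\<phi> / real k1 - (real k1 - real ?\<phi>) / real k2) * (1 / real k1 + 1 / real k2)"
    unfolding sum_contrast_times[OF h] X by (simp only: factor)
  also have "\<dots> = (real ?\<phi> * real v - (real k1)\<^sup>2) / (real k1 * real k2)"
  proof -
    have "p * q / (p + q) * (t / p - (p - t) / q) * (1 / p + 1 / q) = (t * (p + q) - p\<^sup>2) / (p * q)"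
      if "p > 0" "q > 0" for p q t :: real
    proof -
      have "t / p - (p - t) / q = (t * (p + q) - p\<^sup>2) / (p * q)" "1 / p + 1 / q = (p + q) / (p * q)"
        using that by (simp_all add: field_simps power2_eq_square)
      then show ?thesis using that add_pos_pos[OF that] by simp
    qed
    from this[of "real k1" "real k2" "real ?\<phi>"] show ?thesis using pos v by simp
  qed
  finally show ?thesis .
qed

lemma contrast_norm:
  assumes "h < r"
  shows "(\<Sum>i<v. contrast k1 k2 d h i * contrast k1 k2 d h i) = 1"
  unfolding contrast_inner_product[OF assms assms]
  using replicate_blocks[OF assms] pos v by (simp add: concurrence_def field_simps power2_eq_square)

text \<open>
  For each replicate the two blocks contribute the projection onto the span of their indicator vectors,
  which is the projection onto the constants plus the projection onto the contrast.
\<close>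
lemma information_mat_index:
  assumes ij: "i < v" "j < v"
  shows "information_mat v r k1 k2 d $$ (i, j) = (if i = j then real r else 0) -
    (real r / real v + (\<Sum>h<r. contrast k1 k2 d h i * contrast k1 k2 d h j))"
proof -
  let ?N = "incidence_mat v r d"
  let ?g = "\<lambda>l. if even l then 1 / real k1 else 1 / real k2"
  have pairs: "(\<Sum>l<2 * m. F l) = (\<Sum>h<m. F (2 * h) + F (2 * h + 1))" for F :: "nat \<Rightarrow> real" and m
    by (induction m) auto
  have N: "?N \<in> carrier_mat v (2 * r)" by (simp add: incidence_mat_def)
  have "(?N * mat_diag (2 * r) ?g * transpose_mat ?N) $$ (i, j) =
      (\<Sum>l<2 * r. of_bool (i \<in> block d l) * ?g l * of_bool (j \<in> block d l))"
    unfolding mat_diag_mult_right[OF N] using ij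
    by (auto simp: scalar_prod_def incidence_mat_def lessThan_atLeast0 intro!: sum.cong)
  also have "\<dots> = (\<Sum>h<r. 1 / real v + contrast k1 k2 d h i * contrast k1 k2 d h j)"
    unfolding pairs
  proof (rule sum.cong[OF refl])
    fix h assume "h \<in> {..<r}"
    then have snd_iff: "l \<in> snd (d h) \<longleftrightarrow> l \<notin> fst (d h)" if "l < v" for l
      using replicate_blocks(3)[of h] that by auto
    have w: "contrast k1 k2 d h i * contrast k1 k2 d h j = (real k1 * real k2 / real v) *
        ((if i \<in> fst (d h) then 1 / real k1 else - (1 / real k2)) *
         (if j \<in> fst (d h) then 1 / real k1 else - (1 / real k2)))"
      by (simp add: contrast_def v)
    have frac: "p * q / (p + q) * (1 / p * (1 / p)) = 1 / p - 1 / (p + q)"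
      "p * q / (p + q) * (1 / q * (1 / q)) = 1 / q - 1 / (p + q)"
      "p * q / (p + q) * (1 / p * (1 / q)) = 1 / (p + q)" if "p > 0" "q > 0" for p q :: real
      using that add_pos_pos[OF that] by (simp_all add: divide_simps add_eq_0_iff algebra_simps)
    note frac = frac[of "real k1" "real k2"]
    show "of_bool (i \<in> block d (2 * h)) * ?g (2 * h) * of_bool (j \<in> block d (2 * h)) +
        of_bool (i \<in> block d (2 * h + 1)) * ?g (2 * h + 1) * of_bool (j \<in> block d (2 * h + 1)) =
        1 / real v + contrast k1 k2 d h i * contrast k1 k2 d h j"
      unfolding w using snd_iff[OF ij(1)] snd_iff[OF ij(2)] pos frac
      by (auto simp: block_def v mult.commute)
  qed
  finally show ?thesis
    using ij unfolding information_mat_def mat_inverse_block_size_mat[OF pos]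
    by (simp add: sum.distrib incidence_mat_def)
qed

lemma information_mat_carrier: "information_mat v r k1 k2 d \<in> carrier_mat v v"
  unfolding information_mat_def incidence_mat_def by auto

section \<open>The spectrum of the information matrix\<close>

text \<open>
  Normalising the constants too, put \<open>P = [sqrt(r / v) 1, w\<^sub>0, \<dots>]\<close>; the first column has squared norm
  \<open>r\<close>. Then \<open>C = r I - P P'\<close>, while \<open>r I - P' P\<close> is block diagonal with blocks \<open>0\<close> and \<open>H\<close>, since the
  contrasts are orthogonal to the first column. Exchanging \<open>P\<close> and \<open>P'\<close> gives the factorisation, the
  power of \<open>x - r\<close> making up for the difference of the sizes \<open>v\<close> and \<open>1 + r\<close>.
\<close>
lemma char_poly_information_mat:
  assumes "r + 1 \<le> v"
  shows "char_poly (information_mat v r k1 k2 d) =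
    [:- real r, 1:] ^ (v - 1 - r) * [:0, 1:] * char_poly (reduced_mat v r k1 k2 d)"
proof -
  let ?C = "information_mat v r k1 k2 d" and ?H = "reduced_mat v r k1 k2 d"
  define P where "P = mat v (1 + r)
    (\<lambda>(i, a). if a = 0 then sqrt (real r / real v) else contrast k1 k2 d (a - 1) i)"
  have P: "P \<in> carrier_mat v (1 + r)" by (simp add: P_def)
  have C: "?C = real r \<cdot>\<^sub>m 1\<^sub>m v - P * transpose_mat P"
  proof (rule eq_matI)
    fix i j
    assume "i < dim_row (real r \<cdot>\<^sub>m 1\<^sub>m v - P * transpose_mat P)"
      and "j < dim_col (real r \<cdot>\<^sub>m 1\<^sub>m v - P * transpose_mat P)"
    then have ij: "i < v" "j < v" using P by auto
    have "(P * transpose_mat P) $$ (i, j) = (\<Sum>a<Suc r. P $$ (i, a) * P $$ (j, a))"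
      using P ij by (auto simp: scalar_prod_def lessThan_atLeast0)
    also have "\<dots> = real r / real v + (\<Sum>h<r. contrast k1 k2 d h i * contrast k1 k2 d h j)"
      unfolding sum.lessThan_Suc_shift using ij by (simp add: P_def)
    finally show "?C $$ (i, j) = (real r \<cdot>\<^sub>m 1\<^sub>m v - P * transpose_mat P) $$ (i, j)"
      using P ij by (simp add: information_mat_index)
  qed (use information_mat_carrier P in auto)
  have H: "real r \<cdot>\<^sub>m 1\<^sub>m (1 + r) - transpose_mat P * P =
      four_block_mat (0\<^sub>m 1 1) (0\<^sub>m 1 r) (0\<^sub>m r 1) ?H"
  proof (rule eq_matI)
    fix a b
    assume "a < dim_row (four_block_mat (0\<^sub>m 1 1) (0\<^sub>m 1 r) (0\<^sub>m r 1) ?H)"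
      and "b < dim_col (four_block_mat (0\<^sub>m 1 1) (0\<^sub>m 1 r) (0\<^sub>m r 1) ?H)"
    then have ab: "a < Suc r" "b < Suc r" by (auto simp: reduced_mat_def)
    have "(transpose_mat P * P) $$ (a, b) = (\<Sum>i<v. P $$ (i, a) * P $$ (i, b))"
      using P ab by (auto simp: scalar_prod_def lessThan_atLeast0)
    also have "\<dots> = (if a = 0 \<and> b = 0 then real r
        else if a = 0 \<or> b = 0 then 0
        else (\<Sum>i<v. contrast k1 k2 d (a - 1) i * contrast k1 k2 d (b - 1) i))"
      using ab pos v sum_contrast[of "a - 1"] sum_contrast[of "b - 1"]
      by (cases a; cases b) (simp_all add: P_def flip: sum_distrib_left sum_distrib_right)
    finally show "(real r \<cdot>\<^sub>m 1\<^sub>m (1 + r) - transpose_mat P * P) $$ (a, b) =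
        four_block_mat (0\<^sub>m 1 1) (0\<^sub>m 1 r) (0\<^sub>m r 1) ?H $$ (a, b)"
      using P ab by (cases a; cases b) (simp_all add: reduced_mat_def)
  qed (use P in \<open>auto simp: reduced_mat_def\<close>)
  have "char_poly (0\<^sub>m 1 1 :: real mat) = [:0, 1:]"
    by (subst char_poly_upper_triangular[of _ 1]) (auto simp: diag_mat_def)
  then have "char_poly (real r \<cdot>\<^sub>m 1\<^sub>m (1 + r) - transpose_mat P * P) = [:0, 1:] * char_poly ?H"
    unfolding H by (subst char_poly_four_block_zeros_col) auto
  then have "char_poly ?C * [:- real r, 1:] ^ (1 + r) = [:- real r, 1:] ^ v * ([:0, 1:] * char_poly ?H)"
    using char_poly_scalar_minus_mult_swap[OF P, of "transpose_mat P" "real r"] P unfolding C by simp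
  also have "[:- real r, 1:] ^ v = [:- real r, 1:] ^ (v - 1 - r) * [:- real r, 1:] ^ (1 + r)"
    using assms by (subst power_add[symmetric]) simp
  finally have "char_poly ?C * [:- real r, 1:] ^ (1 + r) =
      ([:- real r, 1:] ^ (v - 1 - r) * [:0, 1:] * char_poly ?H) * [:- real r, 1:] ^ (1 + r)"
    by (simp only: mult_ac)
  moreover have "[:- real r, 1:] ^ (1 + r) \<noteq> 0" by (subst power_eq_0_iff) simp
  ultimately show ?thesis by (simp only: mult_cancel_right simp_thms)
qed

lemma reduced_mat_trace: "(\<Sum>a<r. reduced_mat v r k1 k2 d $$ (a, a)) = real r * (real r - 1)"
  by (simp add: reduced_mat_def contrast_norm)

text \<open>
  An eigenvector \<open>y\<close> of \<open>H\<close> for \<open>e\<close> satisfies \<open>W' W y = (r - e) y\<close>. The vector \<open>x = W y\<close> gives the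
  bound on \<open>e\<close> and, if \<open>e = 0\<close>, a second vector in the kernel of the information matrix.
\<close>
lemma reduced_mat_eigenvector_lifts:
  assumes e: "eigenvalue (reduced_mat v r k1 k2 d) e"
  obtains x y where
    "\<And>i. x i = (\<Sum>a<r. contrast k1 k2 d a i * y a)"
    "\<And>a. a < r \<Longrightarrow> (\<Sum>i<v. contrast k1 k2 d a i * x i) = (real r - e) * y a"
    "(\<Sum>i<v. (x i)\<^sup>2) = (real r - e) * (\<Sum>a<r. (y a)\<^sup>2)"
    "(\<Sum>a<r. (y a)\<^sup>2) > 0"
proof -
  let ?H = "reduced_mat v r k1 k2 d" and ?w = "contrast k1 k2 d"
  obtain z where z: "z \<in> carrier_vec r" "z \<noteq> 0\<^sub>v r" "?H *\<^sub>v z = e \<cdot>\<^sub>v z"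
    using e unfolding eigenvalue_def eigenvector_def by (auto simp: reduced_mat_def)
  define y where "y a = z $ a" for a
  define x where "x i = (\<Sum>a<r. ?w a i * y a)" for i
  have gram: "(\<Sum>i<v. ?w a i * x i) = (real r - e) * y a" if a: "a < r" for a
  proof -
    have "(?H *\<^sub>v z) $ a = (e \<cdot>\<^sub>v z) $ a" using z by simp
    then have "(\<Sum>b<r. ?H $$ (a, b) * y b) = e * y a"
      using a z(1) by (auto simp: scalar_prod_def lessThan_atLeast0 reduced_mat_def y_def)
    moreover have "(\<Sum>b<r. ?H $$ (a, b) * y b) =
        (\<Sum>b<r. if a = b then real r * y b else 0) - (\<Sum>b<r. \<Sum>i<v. ?w a i * (?w b i * y b))"
      unfolding sum_subtractf[symmetric] using a
      by (intro sum.cong) (auto simp: reduced_mat_def left_diff_distrib sum_distrib_right mult.assoc)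
    moreover have "(\<Sum>b<r. \<Sum>i<v. ?w a i * (?w b i * y b)) = (\<Sum>i<v. ?w a i * x i)"
      unfolding x_def sum_distrib_left by (rule sum.swap)
    ultimately show ?thesis using a by (simp add: algebra_simps)
  qed
  have "(\<Sum>i<v. (x i)\<^sup>2) = (\<Sum>i<v. \<Sum>a<r. y a * (?w a i * x i))"
    by (intro sum.cong) (simp_all add: x_def power2_eq_square sum_distrib_left sum_distrib_right mult_ac)
  also have "\<dots> = (\<Sum>a<r. \<Sum>i<v. y a * (?w a i * x i))" by (rule sum.swap)
  also have "\<dots> = (\<Sum>a<r. y a * ((real r - e) * y a))"
    by (intro sum.cong refl) (simp add: gram flip: sum_distrib_left)
  also have "\<dots> = (real r - e) * (\<Sum>a<r. (y a)\<^sup>2)"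
    by (simp add: sum_distrib_left power2_eq_square mult_ac)
  finally have norm: "(\<Sum>i<v. (x i)\<^sup>2) = (real r - e) * (\<Sum>a<r. (y a)\<^sup>2)" .
  obtain a where "a < r" "z $ a \<noteq> 0" using z by (metis eq_vecI carrier_vecD index_zero_vec)
  then have "(\<Sum>a<r. (y a)\<^sup>2) > 0" unfolding y_def by (intro sum_pos2[of _ a]) auto
  from that[OF x_def gram norm this] show ?thesis .
qed

lemma eigenvalue_reduced_mat_le:
  assumes "eigenvalue (reduced_mat v r k1 k2 d) e"
  shows "e \<le> real r"
proof (rule reduced_mat_eigenvector_lifts[OF assms])
  fix x y :: "nat \<Rightarrow> real"
  assume norm: "(\<Sum>i<v. (x i)\<^sup>2) = (real r - e) * (\<Sum>a<r. (y a)\<^sup>2)" and pos: "(\<Sum>a<r. (y a)\<^sup>2) > 0"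
  have "0 \<le> (real r - e) * (\<Sum>a<r. (y a)\<^sup>2)" unfolding norm[symmetric] by (intro sum_nonneg) auto
  then show ?thesis using pos by (simp add: zero_le_mult_iff)
qed

text \<open>
  If \<open>H y = 0\<close> with \<open>y \<noteq> 0\<close>, then \<open>x = W y\<close> is nonzero, orthogonal to \<open>1\<close>, and satisfies
  \<open>W W' x = r x\<close>, whence \<open>C x = 0\<close>. Together with \<open>C 1 = 0\<close> this leaves at most rank \<open>v - 2\<close>.
\<close>
lemma connected_imp_reduced_mat_nonsingular:
  assumes connected: "connected_design v r k1 k2 d"
  shows "\<not> eigenvalue (reduced_mat v r k1 k2 d) 0"
proof
  let ?C = "information_mat v r k1 k2 d" and ?w = "contrast k1 k2 d"
  assume ev: "eigenvalue (reduced_mat v r k1 k2 d) 0"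
  show False
  proof (rule reduced_mat_eigenvector_lifts[OF ev])
    fix x y :: "nat \<Rightarrow> real"
    assume x: "\<And>i. x i = (\<Sum>a<r. ?w a i * y a)"
      and gram: "\<And>a. a < r \<Longrightarrow> (\<Sum>i<v. ?w a i * x i) = (real r - 0) * y a"
      and norm: "(\<Sum>i<v. (x i)\<^sup>2) = (real r - 0) * (\<Sum>a<r. (y a)\<^sup>2)" and y: "(\<Sum>a<r. (y a)\<^sup>2) > 0"
    have "r > 0" using y by (cases r) auto
    have C_times: "(\<Sum>j<v. ?C $$ (i, j) * g j) =
        real r * g i - (real r / real v * (\<Sum>j<v. g j) + (\<Sum>h<r. ?w h i * (\<Sum>j<v. ?w h j * g j)))"
      if i: "i < v" for i and g :: "nat \<Rightarrow> real"
    proof -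
      have "(\<Sum>j<v. ?C $$ (i, j) * g j) = (\<Sum>j<v. (if i = j then real r * g j else 0) -
          (real r / real v * g j + (\<Sum>h<r. ?w h i * (?w h j * g j))))"
        using i by (intro sum.cong refl)
          (auto simp: information_mat_index algebra_simps sum_distrib_left)
      also have "\<dots> = real r * g i -
          (real r / real v * (\<Sum>j<v. g j) + (\<Sum>j<v. \<Sum>h<r. ?w h i * (?w h j * g j)))"
        using i by (simp add: sum_subtractf sum.distrib sum_distrib_left)
      also have "(\<Sum>j<v. \<Sum>h<r. ?w h i * (?w h j * g j)) = (\<Sum>h<r. \<Sum>j<v. ?w h i * (?w h j * g j))"
        by (rule sum.swap)
      finally show ?thesis by (simp only: sum_distrib_left)
    qed
    have sum_x: "(\<Sum>i<v. x i) = 0"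
    proof -
      have "(\<Sum>i<v. x i) = (\<Sum>a<r. (\<Sum>i<v. ?w a i) * y a)"
        unfolding x sum_distrib_right by (rule sum.swap)
      then show ?thesis by (simp add: sum_contrast)
    qed
    have kernel_x: "(\<Sum>j<v. ?C $$ (i, j) * x j) = 0" if "i < v" for i
      unfolding C_times[OF that] sum_x using gram
      by (simp add: x[of i] sum_distrib_left algebra_simps)
    have kernel_1: "(\<Sum>j<v. ?C $$ (i, j) * 1) = 0" if "i < v" for i
    proof -
      have "real v \<noteq> 0" using that by simp
      moreover have "(\<Sum>h<r. ?w h i * (\<Sum>j<v. ?w h j * 1)) = 0"
        using sum_contrast by (intro sum.neutral) simp
      moreover have "(\<Sum>j<v. ?C $$ (i, j) * 1) =
          real r * 1 - (real r / real v * (\<Sum>j<v. 1) + (\<Sum>h<r. ?w h i * (\<Sum>j<v. ?w h j * 1)))"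
        using that by (rule C_times)
      ultimately show ?thesis by simp
    qed
    have "\<exists>b<v. x b \<noteq> x 0"
    proof (rule ccontr)
      assume "\<not> ?thesis"
      then have const: "x b = x 0" if "b < v" for b using that by blast
      have "(\<Sum>i<v. x i) = (\<Sum>i<v. x 0)" by (intro sum.cong refl const) simp
      then have "real v * x 0 = 0" using sum_x by simp
      then have "x b = 0" if "b < v" for b using const[OF that] pos v by simp
      then have "(\<Sum>i<v. (x i)\<^sup>2) = 0" by simp
      then show False using norm y \<open>r > 0\<close> by simp
    qed
    then obtain b where b: "b < v" "x b \<noteq> x 0" by blast
    have "vec_space.rank v ?C \<le> v - 2"
    proof (rule vec_space.rank_le_if_two_kernel_vectors[OF information_mat_carrier kernel_1 kernel_x])
      show "0 < v" using b(1) by simp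
      show "b < v" by (fact b(1))
      show "1 * x b - 1 * x 0 \<noteq> 0" using b(2) by simp
    qed
    then show False using connected pos v unfolding connected_design_def by simp
  qed
qed

text \<open>
  The differences \<open>r - e\<close> are eigenvalues of a Gram matrix, hence nonnegative, and they sum to its trace
  \<open>r\<close>. So none of them exceeds \<open>r\<close>, which gives \<open>e \<ge> 0\<close>; connectedness excludes \<open>e = 0\<close>.
\<close>
lemma reduced_mat_spectrum:
  assumes connected: "connected_design v r k1 k2 d"
  obtains es where "char_poly (reduced_mat v r k1 k2 d) = (\<Prod>e\<leftarrow>es. [:- e, 1:])"
    "length es = r" "sum_list es = real r * (real r - 1)" "\<And>e. e \<in> set es \<Longrightarrow> e > 0"
proof -
  let ?H = "reduced_mat v r k1 k2 d"
  have "?H $$ (a, b) = ?H $$ (b, a)" if "a < r" "b < r" for a b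
    using that by (simp add: reduced_mat_def mult.commute)
  from real_symmetric_char_poly_splits[OF reduced_mat_carrier this]
  obtain es where es: "char_poly ?H = (\<Prod>e\<leftarrow>es. [:- e, 1:])" and len: "length es = r" by blast
  have sum: "sum_list es = real r * (real r - 1)"
    using sum_roots_char_poly[OF reduced_mat_carrier es] by (simp add: reduced_mat_trace)
  have ev: "eigenvalue ?H e" if "e \<in> set es" for e
    unfolding eigenvalue_root_char_poly[OF reduced_mat_carrier] es
    using that by (simp add: poly_prod_list prod_list_zero_iff)
  have "e > 0" if e: "e \<in> set es" for e
  proof -
    have "(\<Sum>e\<leftarrow>es. real r - e) = real r"
      using len sum by (simp add: sum_list_subtractf sum_list_triv algebra_simps)
    moreover have "(\<Sum>e\<leftarrow>es. real r - e) = (real r - e) + (\<Sum>e\<leftarrow>remove1 e es. real r - e)"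
      using e by (rule sum_list_map_remove1)
    moreover have "(\<Sum>e\<leftarrow>remove1 e es. real r - e) \<ge> 0"
      using eigenvalue_reduced_mat_le[OF ev] set_remove1_subset[of e es] by (intro sum_list_nonneg) auto
    moreover have "e \<noteq> 0" using connected_imp_reduced_mat_nonsingular[OF connected] ev[OF e] by auto
    ultimately show ?thesis by linarith
  qed
  with es len sum show ?thesis by (rule that)
qed

lemma sum_eigenval:
  assumes es: "char_poly (reduced_mat v r k1 k2 d) = (\<Prod>e\<leftarrow>es. [:- e, 1:])"
    and len: "length es = r" and nz: "\<And>e. e \<in> set es \<Longrightarrow> e > 0" and r: "0 < r" "r + 1 \<le> v"
  shows "(\<Sum>i = 1..v - 1. f (eigenval v r k1 k2 d i)) = real (v - 1 - r) * f (real r) + (\<Sum>e\<leftarrow>es. f e)"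
proof -
  let ?l = "nonzero_eigenvalues v r k1 k2 d"
  have linear: "proots (\<Prod>e\<leftarrow>xs. [:- e, 1:]) = mset xs" "(\<Prod>e\<leftarrow>xs. [:- e, 1:]) \<noteq> 0" for xs :: "real list"
    by (induction xs) (simp_all add: proots_mult del: mult_pCons_left)
  have "proots (char_poly (information_mat v r k1 k2 d)) =
      proots ([:- real r, 1:] ^ (v - 1 - r) * ([:0, 1:] * (\<Prod>e\<leftarrow>es. [:- e, 1:])))"
    by (simp only: char_poly_information_mat[OF r(2)] es mult.assoc)
  also have "\<dots> = proots ([:- real r, 1:] ^ (v - 1 - r)) + (proots [:0, 1:] + proots (\<Prod>e\<leftarrow>es. [:- e, 1:]))"
  proof -
    have nz: "[:- real r, 1:] ^ (v - 1 - r) \<noteq> 0" "[:0, 1 :: real:] \<noteq> 0" by simp_all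
    show ?thesis
      by (simp only: proots_mult[OF nz(1) no_zero_divisors[OF nz(2) linear(2)]] proots_mult[OF nz(2) linear(2)])
  qed
  also have "\<dots> = replicate_mset (v - 1 - r) (real r) + ({#0#} + mset es)"
    unfolding linear(1) proots_power proots_linear_factor by (simp add: repeat_mset_replicate_mset)
  finally have "filter_mset (\<lambda>x. x \<noteq> 0) (proots (char_poly (information_mat v r k1 k2 d))) =
      replicate_mset (v - 1 - r) (real r) + filter_mset (\<lambda>x. x \<noteq> 0) (mset es)"
    using r by (auto simp: filter_mset_eq_conv)
  also have "filter_mset (\<lambda>x. x \<noteq> 0) (mset es) = mset es"
    using nz by (auto simp: filter_mset_eq_conv)
  finally have mset: "mset ?l = replicate_mset (v - 1 - r) (real r) + mset es"
    by (simp add: nonzero_eigenvalues_def)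
  then have "length ?l = v - 1 - r + r" using len by (metis size_mset size_union size_replicate_mset)
  then have "length ?l = v - 1" using r by simp
  then have "(\<Sum>i = 1..v - 1. f (eigenval v r k1 k2 d i)) = (\<Sum>i<length ?l. map f ?l ! i)"
    unfolding eigenval_def
    by (intro sum.reindex_bij_witness[of _ Suc "\<lambda>i. i - 1"]) auto
  also have "\<dots> = sum_list (map f ?l)" by (simp add: sum_list_sum_nth lessThan_atLeast0)
  also have "\<dots> = (\<Sum>x\<in>#mset ?l. f x)" by (metis mset_map sum_mset_sum_list)
  also have "\<dots> = real (v - 1 - r) * f (real r) + (\<Sum>e\<leftarrow>es. f e)"
    unfolding mset by (simp add: image_replicate_mset sum_mset_replicate_mset flip: mset_map sum_mset_sum_list)
  finally show ?thesis .
qed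

text \<open>With this concurrence the contrasts are orthonormal, so \<open>H = (r - 1) I\<close>.\<close>
lemma ECD_char_poly_reduced_mat:
  assumes dvd: "(k1 + k2) dvd k1\<^sup>2" and ecd: "is_ECD r (k1\<^sup>2 div (k1 + k2)) d"
  shows "char_poly (reduced_mat v r k1 k2 d) = (\<Prod>e\<leftarrow>replicate r (real r - 1). [:- e, 1:])"
proof -
  have inner: "(\<Sum>i<v. contrast k1 k2 d a i * contrast k1 k2 d b i) = 0"
    if "a < r" "b < r" "a \<noteq> b" for a b
  proof -
    have "concurrence d a b * v = k1\<^sup>2"
      using ecd that dvd v unfolding is_ECD_def by simp
    then have "real (concurrence d a b) * real v = (real k1)\<^sup>2"
      by (metis of_nat_mult of_nat_power)
    then show ?thesis using contrast_inner_product[OF that(1,2)] by simp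
  qed
  have "upper_triangular (reduced_mat v r k1 k2 d)"
    by (auto simp: upper_triangular_def reduced_mat_def inner)
  moreover have "diag_mat (reduced_mat v r k1 k2 d) = replicate r (real r - 1)"
    by (intro nth_equalityI) (auto simp: diag_mat_def reduced_mat_def contrast_norm)
  ultimately show ?thesis by (simp add: char_poly_upper_triangular[OF reduced_mat_carrier])
qed

end

section \<open>Schur optimality\<close>

lemma convex_on_sum_list_ge_mean:
  fixes f :: "real \<Rightarrow> real"
  assumes "convex_on C f" "set xs \<subseteq> C" "xs \<noteq> []"
  shows "real (length xs) * f (sum_list xs / real (length xs)) \<le> (\<Sum>x\<leftarrow>xs. f x)"
proof -
  let ?n = "length xs"
  have n: "real ?n > 0" using assms(3) by simp
  have "f (\<Sum>i<?n. (1 / real ?n) *\<^sub>R (xs ! i)) \<le> (\<Sum>i<?n. (1 / real ?n) * f (xs ! i))"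
    using assms n by (intro convex_on_sum[OF _ _ assms(1)]) auto
  then have "f (sum_list xs / real ?n) \<le> (\<Sum>x\<leftarrow>xs. f x) / real ?n"
    by (simp add: sum_list_sum_nth lessThan_atLeast0 sum_divide_distrib)
  then show ?thesis using n by (simp add: field_simps)
qed

theorem theorem4:
  fixes k1 k2 v r :: nat and d' :: design
  assumes "k1 \<ge> k2" and "k2 \<ge> 2"
    and "v = k1 + k2"
    and "2 \<le> r" and "r \<le> v - 1"
    and "(k1 + k2) dvd k1\<^sup>2"
    and "d' \<in> design_class v r k1 k2"
    and "is_ECD r (k1\<^sup>2 div (k1 + k2)) d'"
  shows "Schur_optimal v r k1 k2 d'"
  unfolding Schur_optimal_def
proof (intro conjI ballI allI impI)
  fix d and f :: "real \<Rightarrow> real"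
  assume d: "d \<in> design_class v r k1 k2" and f: "convex_on {0<..} f"
  have pos: "k1 > 0" "k2 > 0" and r: "0 < r" "r + 1 \<le> v" using assms by auto
  have des: "is_design v r k1 k2 d" "connected_design v r k1 k2 d" "is_design v r k1 k2 d'"
    using d assms(7) by (auto simp: design_class_def)
  obtain es where es: "char_poly (reduced_mat v r k1 k2 d) = (\<Prod>e\<leftarrow>es. [:- e, 1:])"
    and len: "length es = r" and sum: "sum_list es = real r * (real r - 1)"
    and es_pos: "\<And>e. e \<in> set es \<Longrightarrow> e > 0"
    using reduced_mat_spectrum[OF pos assms(3) des(1,2)] by metis
  have "(\<Sum>i = 1..v - 1. f (eigenval v r k1 k2 d' i)) =
      real (v - 1 - r) * f (real r) + (\<Sum>e\<leftarrow>replicate r (real r - 1). f e)"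
    using assms(4) r
    by (intro sum_eigenval[OF pos assms(3) des(3) ECD_char_poly_reduced_mat[OF pos assms(3) des(3) assms(6,8)]]) auto
  also have "(\<Sum>e\<leftarrow>replicate r (real r - 1). f e) = real (length es) * f (sum_list es / real (length es))"
    using len sum r by (simp add: sum_list_replicate)
  also have "\<dots> \<le> (\<Sum>e\<leftarrow>es. f e)"
    using len r es_pos by (intro convex_on_sum_list_ge_mean[OF f]) auto
  also have "real (v - 1 - r) * f (real r) + (\<Sum>e\<leftarrow>es. f e) = (\<Sum>i = 1..v - 1. f (eigenval v r k1 k2 d i))"
    using sum_eigenval[OF pos assms(3) des(1) es len es_pos r] by simp
  finally show "(\<Sum>i = 1..v - 1. f (eigenval v r k1 k2 d' i)) \<le> (\<Sum>i = 1..v - 1. f (eigenval v r k1 k2 d i))"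
    by simp
qed (use assms in simp)

end
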